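(* Let $1\le k\le M$ and $x>0$. Let $\rho_i=\min\{|g_i|^2,|h_i|^2\}$ and let $i^*$ be the index of the $k$-th largest among $\rho_1,\dots,\rho_M$ (max-min selection, MMS). Then the outage probability $\Pi^{(k)}_{\rm MMS}(x)=\mathbb P\{X_{i^*}\le x\}$ is $$\Pi^{(k)}_{\rm MMS}(x)=k\binom Mk\sum_{m=0}^{M-k}(-1)^m\binom{M-k}{m}\left(\frac{1-\exp(-2\delta s)}{\delta}-\int_0^s\exp\left(-w-(2\delta-1)y\right)dy-\int_r^s\exp\left(-v-(2\delta-1)z\right)dz\right),$$ where $\delta=k+m$, $r=\frac{\sigma_n^2ct_2x}{t_1(ac-b)}$, $s=\sqrt{\frac{r^2}{4}+\frac{cr}{P_t}}+\frac r2$, $w=w(y)=r+\frac{cr}{P_ty}$, and $v=v(z)=-\frac{cr}{P_t(r-z)}$.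
   Context: There are $M\ge 1$ devices. The channel gains $|g_1|^2,\dots,|g_M|^2,|h_1|^2,\dots,|h_M|^2$ are independent exponential random variables with mean $1$. Parameters: $P_t>0$, $\sigma_n^2>0$, $0<t_1<1$, $t_2=1-t_1$, and real constants $a,b,c$ with $c>0$ and $ac-b>0$. The energy harvested by device $i$ is $E_i=t_1\left(\frac{aP_t|g_i|^2+b}{P_t|g_i|^2+c}-\frac bc\right)$, and the SNR of device $i$ is $X_i=\frac{|h_i|^2}{t_2\sigma_n^2}E_i$. The outage probability at rate threshold $Q>0$ is $\mathbb P\{t_2\log_2(1+X)\le Q\}=\mathbb P\{X\le x\}$ with $x=2^{Q/t_2}-1$. The $\rho_i$ are almost surely distinct, so $i^*$ is almost surely well defined. *)

theory Defs
  imports "HOL-Probability.Probability"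
begin

text \<open>
  \<open>harvested_energy a b c Pt t1 u\<close>: energy harvested by a device whose energy-transfer channel
  has gain \<open>u = |g|\<^sup>2\<close>.
\<close>

definition harvested_energy :: "real \<Rightarrow> real \<Rightarrow> real \<Rightarrow> real \<Rightarrow> real \<Rightarrow> real \<Rightarrow> real" where
  "harvested_energy a b c Pt t1 u = t1 * ((a * Pt * u + b) / (Pt * u + c) - b / c)"

text \<open>
  \<open>snr a b c Pt t1 N u v\<close>: signal-to-noise ratio of a device with channel gains
  \<open>u = |g|\<^sup>2\<close> and \<open>v = |h|\<^sup>2\<close>, where \<open>N = \<sigma>\<^sub>n\<^sup>2\<close> is the noise power and
  \<open>t\<^sub>2 = 1 - t\<^sub>1\<close>.
\<close>

definition snr ::
  "real \<Rightarrow> real \<Rightarrow> real \<Rightarrow> real \<Rightarrow> real \<Rightarrow> real \<Rightarrow> real \<Rightarrow> real \<Rightarrow> real" where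
  "snr a b c Pt t1 N u v = v / ((1 - t1) * N) * harvested_energy a b c Pt t1 u"

text \<open>
  The index of the \<open>k\<close>-th largest of \<open>\<rho> 1, \<dots>, \<rho> M\<close>, for \<open>1 \<le> k \<le> M\<close>. Since
  \<^const>\<open>sort_key\<close> is stable, ties go to the smaller index, which makes the function total; for
  random \<open>\<rho>\<close> with almost surely distinct values the choice only matters on a null event.
\<close>

definition kth_largest_index :: "nat \<Rightarrow> nat \<Rightarrow> (nat \<Rightarrow> real) \<Rightarrow> nat" where
  "kth_largest_index M k \<rho> = sort_key (\<lambda>i. - \<rho> i) [1..<Suc M] ! (k - 1)"

lemma kth_largest_index_in:
  assumes "1 \<le> k" "k \<le> M"
  shows "kth_largest_index M k \<rho> \<in> {1..M}"
proof -
  let ?xs = "sort_key (\<lambda>i. - \<rho> i) [1..<Suc M]"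
  have "?xs ! (k - 1) \<in> set ?xs"
    using assms by (intro nth_mem) auto
  then show ?thesis
    by (simp add: kth_largest_index_def atLeastLessThanSuc_atLeastAtMost del: upt_Suc)
qed

lemma card_greater_kth_largest:
  assumes k: "1 \<le> k" "k \<le> M" and inj: "inj_on \<rho> {1..M}"
  shows "card {j \<in> {1..M}. \<rho> j > \<rho> (kth_largest_index M k \<rho>)} = k - 1"
proof -
  define xs where "xs = sort_key (\<lambda>i. - \<rho> i) [1..<Suc M]"
  have len: "length xs = M" and set: "set xs = {1..M}" and dist: "distinct xs"
    by (simp_all add: xs_def atLeastLessThanSuc_atLeastAtMost del: upt_Suc)
  have srt: "sorted (map (\<lambda>i. - \<rho> i) xs)"
    by (simp add: xs_def del: upt_Suc)
  have less_iff: "\<rho> (xs ! p) > \<rho> (xs ! q) \<longleftrightarrow> p < q" if "p < M" "q < M" for p q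
  proof -
    have le: "\<rho> (xs ! p') \<ge> \<rho> (xs ! q')" if "p' \<le> q'" "q' < M" for p' q'
      using sorted_nth_mono[OF srt, of p' q'] that len by simp
    have ne: "\<rho> (xs ! p) \<noteq> \<rho> (xs ! q)" if "p \<noteq> q"
    proof
      assume "\<rho> (xs ! p) = \<rho> (xs ! q)"
      moreover have "xs ! p \<in> {1..M}" "xs ! q \<in> {1..M}"
        using \<open>p < M\<close> \<open>q < M\<close> len set nth_mem by metis+
      ultimately have "xs ! p = xs ! q"
        using inj by (auto dest: inj_onD)
      then show False
        using that \<open>p < M\<close> \<open>q < M\<close> dist len by (simp add: nth_eq_iff_index_eq)
    qed
    show ?thesis
      using le[of p q] le[of q p] ne that by (cases p q rule: linorder_cases) auto
  qed
  have "{j \<in> {1..M}. \<rho> j > \<rho> (xs ! (k - 1))} = (!) xs ` {..<k - 1}"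
  proof (intro equalityI subsetI)
    fix j assume j: "j \<in> {j \<in> {1..M}. \<rho> j > \<rho> (xs ! (k - 1))}"
    then obtain p where p: "p < M" "j = xs ! p"
      using set len by (metis (no_types, lifting) in_set_conv_nth mem_Collect_eq)
    then show "j \<in> (!) xs ` {..<k - 1}"
      using j less_iff[of p "k - 1"] k by auto
  next
    fix j assume "j \<in> (!) xs ` {..<k - 1}"
    then obtain p where p: "p < k - 1" "j = xs ! p" by auto
    then have "j \<in> {1..M}"
      using set len k nth_mem[of p xs] by auto
    then show "j \<in> {j \<in> {1..M}. \<rho> j > \<rho> (xs ! (k - 1))}"
      using p less_iff[of p "k - 1"] k by auto
  qed
  moreover have "inj_on ((!) xs) {..<k - 1}"
    using dist len k by (auto simp: inj_on_def nth_eq_iff_index_eq)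
  ultimately show ?thesis
    by (simp add: kth_largest_index_def xs_def card_image del: upt_Suc)
qed

text \<open>
  Max-min selection. Here \<open>G i \<omega> = |g\<^sub>i|\<^sup>2\<close> and \<open>H i \<omega> = |h\<^sub>i|\<^sup>2\<close> are the
  random channel gains of device \<open>i \<in> {1..M}\<close>.
\<close>

definition mms_index ::
  "nat \<Rightarrow> nat \<Rightarrow> (nat \<Rightarrow> 'a \<Rightarrow> real) \<Rightarrow> (nat \<Rightarrow> 'a \<Rightarrow> real) \<Rightarrow> 'a \<Rightarrow> nat" where
  "mms_index M k G H \<omega> = kth_largest_index M k (\<lambda>i. min (G i \<omega>) (H i \<omega>))"

definition mms_outage ::
  "'a measure \<Rightarrow> nat \<Rightarrow> (nat \<Rightarrow> 'a \<Rightarrow> real) \<Rightarrow> (nat \<Rightarrow> 'a \<Rightarrow> real) \<Rightarrow>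
    real \<Rightarrow> real \<Rightarrow> real \<Rightarrow> real \<Rightarrow> real \<Rightarrow> real \<Rightarrow> nat \<Rightarrow> real \<Rightarrow> real" where
  "mms_outage P M G H a b c Pt t1 N k x =
    measure P {\<omega> \<in> space P.
      (let i = mms_index M k G H \<omega> in snr a b c Pt t1 N (G i \<omega>) (H i \<omega>)) \<le> x}"

end

theory Submission
  imports Defs
begin

text \<open>
  The pairs \<open>Z\<^sub>i = (|g\<^sub>i|\<^sup>2, |h\<^sub>i|\<^sup>2)\<close> are i.i.d. and almost surely have
  distinct minima \<open>\<rho>\<^sub>i\<close>, so the event \<open>i\<^sup>* = i\<close> splits according to the set of the
  \<open>k - 1\<close> devices whose minimum exceeds \<open>\<rho>\<^sub>i\<close>. Conditioning on \<open>Z\<^sub>i\<close> gives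
  \<open>P(Z\<^bsub>i*\<^esub> \<in> A) = k (M choose k) E[1\<^sub>A(Z) T\<^bsup>k-1\<^esup> (1 - T)\<^bsup>M-k\<^esup>]\<close> with
  \<open>T = exp (-2 \<rho>)\<close> the tail of the minimum of two exponentials. Expanding
  \<open>(1 - T)\<^bsup>M-k\<^esup>\<close> binomially leaves the integrals of
  \<open>exp (-u - v - 2 (\<delta> - 1) min u v)\<close> over the outage region \<open>u v \<le> r u + c r / P\<^sub>t\<close>. They
  are computed separately on the two sides of the diagonal, which the boundary hyperbola meets at
  \<open>u = v = s\<close>.
\<close>

subsection \<open>Selecting the k-th largest of independent values\<close>

lemma measurable_insort_key:
  fixes f :: "'i::countable \<Rightarrow> 'a \<Rightarrow> real"
  assumes "\<And>i. i \<in> insert x (set ys) \<Longrightarrow> f i \<in> borel_measurable M"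
  shows "(\<lambda>\<omega>. insort_key (\<lambda>i. f i \<omega>) x ys) \<in> measurable M (count_space UNIV)"
  using assms
proof (induction ys)
  case (Cons y ys)
  have [measurable]: "f x \<in> borel_measurable M" "f y \<in> borel_measurable M"
    "(\<lambda>\<omega>. insort_key (\<lambda>i. f i \<omega>) x ys) \<in> measurable M (count_space UNIV)"
    using Cons by auto
  show ?case by simp
qed simp

lemma measurable_sort_key:
  fixes f :: "'i::countable \<Rightarrow> 'a \<Rightarrow> real"
  assumes "\<And>i. i \<in> set xs \<Longrightarrow> f i \<in> borel_measurable M"
  shows "(\<lambda>\<omega>. sort_key (\<lambda>i. f i \<omega>) xs) \<in> measurable M (count_space UNIV)"
  using assms
proof (induction xs)
  case (Cons x xs)
  have "(\<lambda>\<omega>. insort_key (\<lambda>i. f i \<omega>) x ys) \<in> measurable M (count_space UNIV)"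
    if "ys \<in> {ys. set ys \<subseteq> set xs}" for ys
    using that Cons.prems by (intro measurable_insort_key) auto
  \<comment> \<open>The random list is regarded as taking values in the countable set of lists over
    \<open>set xs\<close>. Insertion is a measurable map only for those lists, because only their
    keys are known to be measurable.\<close>
  moreover have "(\<lambda>\<omega>. sort_key (\<lambda>i. f i \<omega>) xs) \<in> measurable M (count_space {ys. set ys \<subseteq> set xs})"
    using Cons by (auto simp: measurable_count_space_eq2_countable)
  ultimately have "(\<lambda>\<omega>. insort_key (\<lambda>i. f i \<omega>) x (sort_key (\<lambda>i. f i \<omega>) xs)) \<in> measurable M (count_space UNIV)"
    by (rule measurable_compose_countable'[where f="\<lambda>ys \<omega>. insort_key (\<lambda>i. f i \<omega>) x ys"]) auto
  then show ?case by simp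
qed simp

lemma measurable_kth_largest_index:
  assumes "\<And>i. i \<in> {1..n} \<Longrightarrow> \<rho> i \<in> borel_measurable M"
  shows "(\<lambda>\<omega>. kth_largest_index n k (\<lambda>i. \<rho> i \<omega>)) \<in> measurable M (count_space UNIV)"
proof -
  have "(\<lambda>\<omega>. sort_key (\<lambda>i. - \<rho> i \<omega>) [1..<Suc n]) \<in> measurable M (count_space UNIV)"
    using assms by (intro measurable_sort_key) (auto simp del: upt_Suc)
  then show ?thesis
    unfolding kth_largest_index_def by measurable
qed

section \<open>Ties and ranks among independent values\<close>

text \<open>By independence the joint law is a product, and for each fixed value \<open>x\<close> of
  \<open>X\<close> the variable \<open>Y\<close> hits \<open>x\<close> with probability zero. Fubini
  then makes the diagonal a null set.\<close>

lemma (in prob_space) indep_var_AE_neq: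
  fixes X Y :: "'a \<Rightarrow> real"
  assumes "indep_var borel X borel Y" and "\<And>y. prob {\<omega> \<in> space M. Y \<omega> = y} = 0"
  shows "AE \<omega> in M. X \<omega> \<noteq> Y \<omega>"
proof -
  have [measurable]: "random_variable borel X" "random_variable borel Y"
    and eq: "distr M borel X \<Otimes>\<^sub>M distr M borel Y = distr M (borel \<Otimes>\<^sub>M borel) (\<lambda>\<omega>. (X \<omega>, Y \<omega>))"
    using assms(1) by (auto simp: indep_var_distribution_eq)
  interpret Y: prob_space "distr M borel Y" by (rule prob_space_distr) simp
  interpret X: prob_space "distr M borel X" by (rule prob_space_distr) simp
  interpret XY: pair_prob_space "distr M borel X" "distr M borel Y" ..
  have "AE y in distr M borel Y. x \<noteq> y" for x
  proof -
    have "AE \<omega> in M. \<not> Y \<omega> = x"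
      using assms(2)[of x] by (subst (asm) prob_eq_0) auto
    then show ?thesis
      by (subst AE_distr_iff) (auto simp: eq_commute[of x])
  qed
  then have "AE x in distr M borel X. AE y in distr M borel Y. x \<noteq> y" by simp
  then have "AE p in distr M borel X \<Otimes>\<^sub>M distr M borel Y. fst p \<noteq> snd p"
  proof (intro XY.AE_pair_measure)
    show "{p \<in> space (distr M borel X \<Otimes>\<^sub>M distr M borel Y). fst p \<noteq> snd p}
        \<in> sets (distr M borel X \<Otimes>\<^sub>M distr M borel Y)"
      by measurable
  qed simp
  then show ?thesis
    unfolding eq by (subst (asm) AE_distr_iff) auto
qed

text \<open>Given \<open>Z i = z\<close>, every other value independently exceeds
  \<open>\<rho> z\<close> with probability \<open>T z\<close>. Prescribing which ones do, namely
  exactly those in \<open>S\<close>, gives one factor \<open>T z\<close> or \<open>1 - T z\<close>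
  per index other than \<open>i\<close>; integrating over \<open>z\<close> removes the
  conditioning.\<close>

lemma (in prob_space) iid_threshold_prob:
  fixes Z :: "'i \<Rightarrow> 'a \<Rightarrow> 'b" and \<rho> :: "'b \<Rightarrow> real"
  assumes "finite I" "i \<in> I" "S \<subseteq> I - {i}"
    and indep: "indep_vars (\<lambda>_. N) Z I"
    and law: "\<And>j. j \<in> I \<Longrightarrow> distr M N (Z j) = D"
    and \<rho>[measurable]: "\<rho> \<in> borel_measurable N" and [measurable]: "A \<in> sets N"
  defines "T \<equiv> \<lambda>z. measure D {z' \<in> space N. \<rho> z' > \<rho> z}"
  shows "prob {\<omega> \<in> space M. Z i \<omega> \<in> A \<and> {j \<in> I. \<rho> (Z j \<omega>) > \<rho> (Z i \<omega>)} = S} =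
    (\<integral>z. indicator A z * (T z ^ card S * (1 - T z) ^ (card I - 1 - card S)) \<partial>D)"
proof -
  define J where "J = I - {i}"
  have I: "I = insert i J" "i \<notin> J" "finite J" and SJ: "S \<subseteq> J" "finite S"
    using assms(1-3) finite_subset[of S I] by (auto simp: J_def)
  have Zm[measurable]: "j \<in> I \<Longrightarrow> random_variable N (Z j)" for j
    using indep by (auto simp: indep_vars_def)
  have setsD[measurable_cong, simp]: "sets D = sets N" and spD[simp]: "space D = space N"
    using law[OF \<open>i \<in> I\<close>] by auto
  have PiMeq: "PiM I (\<lambda>_. D) = distr M (PiM I (\<lambda>_. N)) (\<lambda>\<omega>. \<lambda>j\<in>I. Z j \<omega>)"
  proof -
    have "distr M (PiM I (\<lambda>_. N)) (\<lambda>\<omega>. \<lambda>j\<in>I. Z j \<omega>) = PiM I (\<lambda>j. distr M N (Z j))"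
      using indep \<open>i \<in> I\<close> Zm by (subst (asm) indep_vars_iff_distr_eq_PiM') auto
    then show ?thesis using law by (simp cong: PiM_cong)
  qed
  interpret D: prob_space D
    using law[OF \<open>i \<in> I\<close>] Zm[OF \<open>i \<in> I\<close>] by (metis prob_space_distr)
  interpret product_prob_space "\<lambda>_. D" I by unfold_locales
  \<comment> \<open>The event in coordinates of the product space. Only \<open>j \<in> J\<close> is
    constrained, since \<open>i\<close> never exceeds itself.\<close>
  define E where "E = {f \<in> space (PiM I (\<lambda>_. N)). f i \<in> A \<and>
    (\<forall>j\<in>J. if j \<in> S then \<rho> (f j) > \<rho> (f i) else \<rho> (f j) \<le> \<rho> (f i))}"
  have E[measurable]: "E \<in> sets (PiM I (\<lambda>_. N))"
  proof -
    have comp: "(\<lambda>f. f j) \<in> measurable (PiM I (\<lambda>_. N)) N" if "j \<in> I" for j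
      using that by (rule measurable_component_singleton)
    have \<rho>m: "(\<lambda>f. \<rho> (f j)) \<in> borel_measurable (PiM I (\<lambda>_. N))" if "j \<in> I" for j
      using comp[OF that] \<rho> by (rule measurable_compose)
    have "Measurable.pred (PiM I (\<lambda>_. N))
        (\<lambda>f. if j \<in> S then \<rho> (f j) > \<rho> (f i) else \<rho> (f j) \<le> \<rho> (f i))" if "j \<in> J" for j
      using that \<rho>m[of i] \<rho>m[of j] I(1)
      by (cases "j \<in> S") (simp_all add: pred_def borel_measurable_less borel_measurable_le)
    then have "Measurable.pred (PiM I (\<lambda>_. N))
        (\<lambda>f. \<forall>j\<in>J. if j \<in> S then \<rho> (f j) > \<rho> (f i) else \<rho> (f j) \<le> \<rho> (f i))"
      using I(3) by (intro pred_intros_finite)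
    moreover have "Measurable.pred (PiM I (\<lambda>_. N)) (\<lambda>f. f i \<in> A)"
      using comp[OF \<open>i \<in> I\<close>] by measurable
    ultimately show ?thesis unfolding E_def by measurable
  qed
  have setsPi: "sets (PiM I (\<lambda>_. D)) = sets (PiM I (\<lambda>_. N))" by (rule sets_PiM_cong) auto
  have Ti: "0 \<le> T z" "T z \<le> 1" for z by (auto simp: T_def)
  have gt: "emeasure D {z' \<in> space N. \<rho> z' > \<rho> z} = ennreal (T z)" for z
    by (simp add: T_def D.emeasure_eq_measure)
  have le: "emeasure D {z' \<in> space N. \<rho> z' \<le> \<rho> z} = ennreal (1 - T z)" for z
  proof -
    have "measure D (space D - {z' \<in> space N. \<rho> z' > \<rho> z}) = 1 - T z"
      unfolding T_def by (intro D.prob_compl) auto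
    also have "space D - {z' \<in> space N. \<rho> z' > \<rho> z} = {z' \<in> space N. \<rho> z' \<le> \<rho> z}" by auto
    finally show ?thesis by (simp add: D.emeasure_eq_measure)
  qed
  \<comment> \<open>With coordinate \<open>i\<close> frozen at \<open>z\<close>, the remaining
    conditions decouple: the slice of \<open>E\<close> is empty or equal to the box
    \<open>Pi\<^sub>E J B\<close>, whose measure factorises.\<close>
  have inner: "(\<integral>\<^sup>+ x. indicator E (x(i := z)) \<partial>PiM J (\<lambda>_. D)) =
      ennreal (indicator A z * (T z ^ card S * (1 - T z) ^ (card I - 1 - card S)))"
    if z: "z \<in> space D" for z
  proof -
    define B where "B j = (if j \<in> S then {z' \<in> space N. \<rho> z' > \<rho> z} else {z' \<in> space N. \<rho> z' \<le> \<rho> z})" for j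
    have B: "B j \<in> sets N" for j unfolding B_def by simp
    have "(\<integral>\<^sup>+ x. indicator E (x(i := z)) \<partial>PiM J (\<lambda>_. D)) =
        (\<integral>\<^sup>+ x. indicator A z * indicator (Pi\<^sub>E J B) x \<partial>PiM J (\<lambda>_. D))"
    proof (rule nn_integral_cong)
      fix x assume "x \<in> space (PiM J (\<lambda>_. D))"
      then have x: "x \<in> (\<Pi>\<^sub>E j\<in>J. space N)" by (simp add: space_PiM)
      have 1: "x(i := z) \<in> space (PiM I (\<lambda>_. N))"
        using x z I by (auto simp: space_PiM PiE_iff extensional_def)
      have 2: "(x(i := z)) j = x j" if "j \<in> J" for j using that I by auto
      have 3: "x(i:=z) \<in> E \<longleftrightarrow> z \<in> A \<and> x \<in> Pi\<^sub>E J B"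
        using x 1 2 by (force simp: E_def B_def PiE_iff)
      then show "indicator E (x(i := z)) = (indicator A z * indicator (Pi\<^sub>E J B) x :: ennreal)"
        by (auto simp: indicator_def)
    qed
    also have "\<dots> = indicator A z * emeasure (PiM J (\<lambda>_. D)) (Pi\<^sub>E J B)"
      using I B by (intro nn_integral_cmult_indicator) (auto intro!: sets_PiM_I_finite)
    also have "emeasure (PiM J (\<lambda>_. D)) (Pi\<^sub>E J B) = (\<Prod>j\<in>J. emeasure D (B j))"
      using I B by (intro emeasure_PiM) auto
    also have "\<dots> = (\<Prod>j\<in>J. if j \<in> S then ennreal (T z) else ennreal (1 - T z))"
      by (intro prod.cong refl) (auto simp: B_def gt le)
    also have "\<dots> = ennreal (T z) ^ card S * ennreal (1 - T z) ^ card (J - S)"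
    proof -
      have "J \<inter> {x. x \<in> S} = S" "J \<inter> - {x. x \<in> S} = J - S" using SJ by auto
      then show ?thesis using I by (simp add: prod.If_cases)
    qed
    also have "card (J - S) = card I - 1 - card S"
      using I SJ by (simp add: card_Diff_subset)
    finally show ?thesis
      using Ti by (cases "z \<in> A") (simp_all add: ennreal_mult ennreal_power fun_upd_def)
  qed
  have "emeasure M {\<omega> \<in> space M. Z i \<omega> \<in> A \<and> {j \<in> I. \<rho> (Z j \<omega>) > \<rho> (Z i \<omega>)} = S} =
     emeasure M ((\<lambda>\<omega>. \<lambda>j\<in>I. Z j \<omega>) -` E \<inter> space M)"
  proof (rule arg_cong[where f="emeasure M"], intro set_eqI)
    fix \<omega>
    have "(\<lambda>j\<in>I. Z j \<omega>) \<in> space (PiM I (\<lambda>_. N))" if "\<omega> \<in> space M"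
      using measurable_space[OF Zm that] by (auto simp: space_PiM)
    moreover have "{j \<in> I. \<rho> (Z j \<omega>) > \<rho> (Z i \<omega>)} = S \<longleftrightarrow>
      (\<forall>j\<in>J. if j \<in> S then \<rho> (Z j \<omega>) > \<rho> (Z i \<omega>) else \<rho> (Z j \<omega>) \<le> \<rho> (Z i \<omega>))"
      using I SJ by (auto simp: not_less[symmetric])
    ultimately show "(\<omega> \<in> {\<omega> \<in> space M. Z i \<omega> \<in> A \<and> {j \<in> I. \<rho> (Z j \<omega>) > \<rho> (Z i \<omega>)} = S}) \<longleftrightarrow>
        \<omega> \<in> (\<lambda>\<omega>. \<lambda>j\<in>I. Z j \<omega>) -` E \<inter> space M"
      using I by (auto simp: E_def)
  qed
  also have "\<dots> = emeasure (PiM I (\<lambda>_. D)) E"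
    unfolding PiMeq by (subst emeasure_distr) auto
  also have "\<dots> = (\<integral>\<^sup>+ f. indicator E f \<partial>PiM I (\<lambda>_. D))"
    by (simp add: setsPi)
  also have "\<dots> = (\<integral>\<^sup>+ z. (\<integral>\<^sup>+ x. indicator E (x(i := z)) \<partial>PiM J (\<lambda>_. D)) \<partial>D)"
    unfolding I(1) using I E
    by (intro product_nn_integral_insert_rev) (auto simp: setsPi I(1)[symmetric])
  also have "\<dots> = (\<integral>\<^sup>+ z. ennreal (indicator A z * (T z ^ card S * (1 - T z) ^ (card I - 1 - card S))) \<partial>D)"
    by (intro nn_integral_cong inner)
  finally show ?thesis
    using Ti by (simp add: measure_def integral_eq_nn_integral T_def)
qed

text \<open>The number of strictly larger values drops strictly as the value grows, so equal counts
  force equal values, and injectivity then forces equal indices.\<close>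

lemma card_greater_eq_iff_kth_largest_index:
  fixes \<rho> :: "nat \<Rightarrow> real"
  assumes k: "1 \<le> k" "k \<le> n" and inj: "inj_on \<rho> {1..n}" and i: "i \<in> {1..n}"
  shows "card {j \<in> {1..n}. \<rho> j > \<rho> i} = k - 1 \<longleftrightarrow> kth_largest_index n k \<rho> = i"
proof
  define i' where "i' = kth_largest_index n k \<rho>"
  have i': "i' \<in> {1..n}" "card {j \<in> {1..n}. \<rho> j > \<rho> i'} = k - 1"
    using kth_largest_index_in[OF k] card_greater_kth_largest[OF k inj] by (auto simp: i'_def)
  have less: "card {j \<in> {1..n}. \<rho> j > \<rho> q} < card {j \<in> {1..n}. \<rho> j > \<rho> p}"
    if "\<rho> p < \<rho> q" "q \<in> {1..n}" for p q
    using that by (intro psubset_card_mono) (auto intro: less_trans)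
  assume "card {j \<in> {1..n}. \<rho> j > \<rho> i} = k - 1"
  then have "\<rho> i = \<rho> i'"
    using less[of i i'] less[of i' i] i i' by (cases "\<rho> i" "\<rho> i'" rule: linorder_cases) auto
  then show "kth_largest_index n k \<rho> = i"
    using inj i i' by (auto simp: i'_def[symmetric] dest: inj_onD)
qed (use card_greater_kth_largest[OF k inj] in auto)

lemma (in prob_space) indep_vars_pair:
  assumes "indep_vars N X I" "i \<in> I" "j \<in> I" "i \<noteq> j"
  shows "indep_var (N i) (X i) (N j) (X j)"
proof -
  have "indep_var (PiM {i} N) (\<lambda>\<omega>. restrict (\<lambda>l. X l \<omega>) {i}) (PiM {j} N) (\<lambda>\<omega>. restrict (\<lambda>l. X l \<omega>) {j})"
    using assms by (intro indep_var_restrict[where I=I]) auto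
  from indep_var_compose[OF this, of "\<lambda>f. f i" "N i" "\<lambda>f. f j" "N j"]
  show ?thesis by (simp add: comp_def measurable_component_singleton)
qed

text \<open>Outside the null event of ties, index \<open>i\<close> is selected iff exactly
  \<open>k - 1\<close> others exceed it. This event splits over the possible sets \<open>S\<close>
  of these others, and every pair \<open>(i, S)\<close> contributes the same integral, so only the
  number of pairs remains to be counted.\<close>

lemma (in prob_space) prob_kth_largest:
  fixes Z :: "nat \<Rightarrow> 'a \<Rightarrow> 'b" and \<rho> :: "'b \<Rightarrow> real"
  assumes k: "1 \<le> k" "k \<le> n"
    and indep: "indep_vars (\<lambda>_. N) Z {1..n}"
    and law: "\<And>j. j \<in> {1..n} \<Longrightarrow> distr M N (Z j) = D"
    and \<rho>: "\<rho> \<in> borel_measurable N" and A[measurable]: "A \<in> sets N"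
    and atomless: "\<And>y. measure D {z \<in> space N. \<rho> z = y} = 0"
  defines "T \<equiv> \<lambda>z. measure D {z' \<in> space N. \<rho> z' > \<rho> z}"
  shows "prob {\<omega> \<in> space M. Z (kth_largest_index n k (\<lambda>i. \<rho> (Z i \<omega>))) \<omega> \<in> A} =
    real k * real (n choose k) *
      (\<integral>z. indicator A z * (T z ^ (k - 1) * (1 - T z) ^ (n - k)) \<partial>D)"
proof -
  define I where "I = {1..n}"
  define J where "J \<omega> = kth_largest_index n k (\<lambda>i. \<rho> (Z i \<omega>))" for \<omega>
  define C where "C i S = {\<omega> \<in> space M. Z i \<omega> \<in> A \<and> {j \<in> I. \<rho> (Z j \<omega>) > \<rho> (Z i \<omega>)} = S}" for i S
  define F where "F i = {S. S \<subseteq> I - {i} \<and> card S = k - 1}" for i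
  let ?E = "\<integral>z. indicator A z * (T z ^ (k - 1) * (1 - T z) ^ (n - k)) \<partial>D"
  have Zm: "random_variable N (Z j)" if "j \<in> I" for j
    using indep that by (auto simp: indep_vars_def I_def)
  have \<rho>Zm: "(\<lambda>\<omega>. \<rho> (Z j \<omega>)) \<in> borel_measurable M" if "j \<in> I" for j
    using measurable_compose[OF Zm[OF that] \<rho>] .
  have J[measurable]: "J \<in> measurable M (count_space UNIV)"
    using \<rho>Zm unfolding J_def I_def by (rule measurable_kth_largest_index)
  have finF: "finite (F i)" for i
    by (rule finite_subset[of _ "Pow I"]) (auto simp: F_def I_def)
  have cardF: "card (F i) = (n - 1) choose (k - 1)" if "i \<in> I" for i
    using that n_subsets[of "I - {i}" "k - 1"] by (simp add: F_def I_def)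
  \<comment> \<open>Equality with \<open>S\<close> amounts to \<open>S \<subseteq> I\<close>
    together with finitely many membership tests, each a comparison of two random variables.\<close>
  have C: "C i S \<in> events" if "i \<in> I" for i S
  proof -
    have "Measurable.pred M (\<lambda>\<omega>. (\<rho> (Z j \<omega>) > \<rho> (Z i \<omega>)) = (j \<in> S))" if "j \<in> I" for j
      using \<rho>Zm[OF that] \<rho>Zm[OF \<open>i \<in> I\<close>]
      by (cases "j \<in> S") (simp_all add: pred_def borel_measurable_less borel_measurable_le not_less)
    then have "Measurable.pred M (\<lambda>\<omega>. \<forall>j\<in>I. (\<rho> (Z j \<omega>) > \<rho> (Z i \<omega>)) = (j \<in> S))"
      by (intro pred_intros_finite) (auto simp: I_def)
    moreover have "Measurable.pred M (\<lambda>\<omega>. Z i \<omega> \<in> A)"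
      using Zm[OF that] by measurable
    ultimately have "{\<omega> \<in> space M. Z i \<omega> \<in> A \<and> S \<subseteq> I \<and> (\<forall>j\<in>I. (\<rho> (Z j \<omega>) > \<rho> (Z i \<omega>)) = (j \<in> S))} \<in> events"
      by measurable
    also have "{\<omega> \<in> space M. Z i \<omega> \<in> A \<and> S \<subseteq> I \<and> (\<forall>j\<in>I. (\<rho> (Z j \<omega>) > \<rho> (Z i \<omega>)) = (j \<in> S))} = C i S"
      by (auto simp: C_def)
    finally show ?thesis .
  qed
  \<comment> \<open>Reduces the exponent \<open>card I - 1 - card S\<close>, that is
    \<open>n - 1 - (k - 1)\<close>, to \<open>n - k\<close>.\<close>
  have k': "Suc (k - Suc 0) = k" using k by simp
  have probC: "prob (C i S) = ?E" if "i \<in> I" "S \<in> F i" for i S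
    using that iid_threshold_prob[of I i S N Z D \<rho> A] indep law \<rho> A
    by (simp add: C_def F_def I_def T_def k')
  have ties: "AE \<omega> in M. \<rho> (Z i \<omega>) \<noteq> \<rho> (Z j \<omega>)" if "i \<in> I" "j \<in> I" "i \<noteq> j" for i j
  proof (rule indep_var_AE_neq)
    have "indep_var N (Z i) N (Z j)"
      using that by (intro indep_vars_pair[OF indep]) (auto simp: I_def)
    then show "indep_var borel (\<lambda>\<omega>. \<rho> (Z i \<omega>)) borel (\<lambda>\<omega>. \<rho> (Z j \<omega>))"
      using indep_var_compose[OF _ \<rho> \<rho>] by (simp add: comp_def)
    show "prob {\<omega> \<in> space M. \<rho> (Z j \<omega>) = y} = 0" for y
    proof -
      have "measure (distr M N (Z j)) {z \<in> space N. \<rho> z = y} =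
          prob (Z j -` {z \<in> space N. \<rho> z = y} \<inter> space M)"
        using Zm[OF that(2)] \<rho> by (intro measure_distr) auto
      also have "Z j -` {z \<in> space N. \<rho> z = y} \<inter> space M = {\<omega> \<in> space M. \<rho> (Z j \<omega>) = y}"
        using measurable_space[OF Zm[OF that(2)]] by auto
      finally show ?thesis
        using atomless law that by (simp add: I_def)
    qed
  qed
  have inj: "AE \<omega> in M. inj_on (\<lambda>i. \<rho> (Z i \<omega>)) I"
  proof -
    have "AE \<omega> in M. \<forall>i\<in>I. \<forall>j\<in>I. i \<noteq> j \<longrightarrow> \<rho> (Z i \<omega>) \<noteq> \<rho> (Z j \<omega>)"
      using ties by (intro AE_finite_allI) (auto simp: I_def)
    then show ?thesis by eventually_elim (auto simp: inj_on_def)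
  qed
  have JI: "J \<omega> \<in> I" for \<omega>
    unfolding J_def I_def by (rule kth_largest_index_in[OF k])
  have sel: "{\<omega> \<in> space M. J \<omega> = i \<and> Z i \<omega> \<in> A} \<in> events" if "i \<in> I" for i
    using Zm[OF that] by measurable
  have "prob {\<omega> \<in> space M. Z (J \<omega>) \<omega> \<in> A} = prob (\<Union>i\<in>I. {\<omega> \<in> space M. J \<omega> = i \<and> Z i \<omega> \<in> A})"
    using JI by (intro arg_cong[where f=prob]) auto
  also have "\<dots> = (\<Sum>i\<in>I. prob {\<omega> \<in> space M. J \<omega> = i \<and> Z i \<omega> \<in> A})"
    using sel by (intro finite_measure_finite_Union) (auto simp: I_def disjoint_family_on_def)
  \<comment> \<open>The two events agree only almost surely: on a tie the count of strictly larger
    values need not identify the index picked by the stable sort.\<close>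
  also have "\<dots> = (\<Sum>i\<in>I. prob (\<Union>S\<in>F i. C i S))"
  proof (intro sum.cong refl finite_measure_eq_AE)
    fix i assume i: "i \<in> I"
    show "AE \<omega> in M. (\<omega> \<in> {\<omega> \<in> space M. J \<omega> = i \<and> Z i \<omega> \<in> A}) = (\<omega> \<in> (\<Union>S\<in>F i. C i S))"
      using inj
    proof eventually_elim
      case (elim \<omega>)
      then have "J \<omega> = i \<longleftrightarrow> {j \<in> I. \<rho> (Z j \<omega>) > \<rho> (Z i \<omega>)} \<in> F i"
        using card_greater_eq_iff_kth_largest_index[OF k, of "\<lambda>i. \<rho> (Z i \<omega>)" i] i
        by (auto simp: F_def I_def J_def)
      then show ?case by (auto simp: C_def)
    qed
  qed (use sel C finF in auto)
  also have "\<dots> = (\<Sum>i\<in>I. \<Sum>S\<in>F i. prob (C i S))"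
    using C finF
    by (intro sum.cong refl finite_measure_finite_Union) (auto simp: disjoint_family_on_def C_def)
  also have "\<dots> = real n * real ((n - 1) choose (k - 1)) * ?E"
    using probC cardF by (simp add: I_def)
  \<comment> \<open>Absorption identity for binomial coefficients.\<close>
  also have "real n * real ((n - 1) choose (k - 1)) = real k * real (n choose k)"
    using k times_binomial_minus1_eq[of k n] by (simp flip: of_nat_mult)
  finally show ?thesis by (simp add: J_def)
qed

subsection \<open>Exponential integrals over the outage region\<close>

abbreviation exp_law :: "real measure" where
  "exp_law \<equiv> density lborel (exponential_density 1)"

interpretation exp_law: prob_space exp_law
  by (rule prob_space_exponential_density) simp

interpretation exp_law_pair: pair_prob_space exp_law exp_law ..

lemma measure_exp_law_greaterThan: "0 \<le> a \<Longrightarrow> measure exp_law {a<..} = exp (- a)"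
  \<comment> \<open>The identity map on \<open>exp_law\<close> serves as the exponentially
    distributed variable.\<close>
  using exp_law.exponential_distributedD_gt[of "\<lambda>x. x" 1 a]
  by (simp add: distributed_def distr_id2 greaterThan_def)

lemma measure_exp_law_singleton: "measure exp_law {y} = 0"
proof -
  have "emeasure exp_law {y} = 0"
    by (subst emeasure_density) (auto simp: nn_integral_null_set)
  then show ?thesis by (simp add: measure_def)
qed

lemma measure_exp_law_greaterThanAtMost:
  assumes "0 \<le> a" "a \<le> b"
  shows "measure exp_law {a<..b} = exp (- a) - exp (- b)"
proof -
  have "measure exp_law ({a<..} - {b<..}) = measure exp_law {a<..} - measure exp_law {b<..}"
    using assms by (intro exp_law.finite_measure_Diff) auto
  also have "{a<..} - {b<..} = {a<..b}" by auto
  finally show ?thesis using assms by (simp add: measure_exp_law_greaterThan)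
qed

lemma measure_exp_law_atLeast:
  assumes "0 \<le> a"
  shows "measure exp_law {a..} = exp (- a)"
proof -
  have "{a..} = {a} \<union> {a<..}" by auto
  then have "measure exp_law {a..} = measure exp_law {a} + measure exp_law {a<..}"
    by (simp only:, intro exp_law.finite_measure_Union) auto
  then show ?thesis using assms by (simp add: measure_exp_law_singleton measure_exp_law_greaterThan)
qed

lemma measure_exp_law_atLeastAtMost:
  assumes "0 \<le> a" "a \<le> b"
  shows "measure exp_law {a..b} = exp (- a) - exp (- b)"
proof -
  have "{a..b} = {a} \<union> {a<..b}" using assms by auto
  then have "measure exp_law {a..b} = measure exp_law {a} + measure exp_law {a<..b}"
    by (simp only:, intro exp_law.finite_measure_Union) auto
  then show ?thesis using assms by (simp add: measure_exp_law_singleton measure_exp_law_greaterThanAtMost)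
qed

lemma AE_exp_law_pos: "AE u in exp_law. 0 < u"
proof -
  have "measure exp_law {0<..} = 1" by (simp add: measure_exp_law_greaterThan)
  then show ?thesis
    using exp_law.prob_eq_1[of "{0<..}"] by simp
qed

lemma AE_exp_law_pair_pos:
  "AE z in exp_law \<Otimes>\<^sub>M exp_law. 0 < fst z \<and> 0 < snd z"
proof (rule exp_law_pair.AE_pair_measure)
  show "AE u in exp_law. AE v in exp_law. 0 < fst (u, v) \<and> 0 < snd (u, v)"
    using AE_exp_law_pos by simp
qed measurable

text \<open>The density vanishes on the negative axis and \<open>{0}\<close> is null, so it suffices
  to know \<open>g\<close> at positive arguments. The cutoff at \<open>s\<close> becomes the upper
  limit of integration.\<close>

lemma integral_exp_law_Icc:
  fixes f g :: "real \<Rightarrow> real"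
  assumes [measurable]: "g \<in> borel_measurable borel"
    and eq: "\<And>u. 0 < u \<Longrightarrow> g u = indicator {..s} u * f u"
  shows "(\<integral>u. g u \<partial>exp_law) = (LINT u:{0..s}|lborel. exp (- u) * f u)"
proof -
  have "(\<integral>u. g u \<partial>exp_law) = (\<integral>u. exponential_density 1 u * g u \<partial>lborel)"
    by (subst integral_density) (auto simp: exponential_density_nonneg)
  also have "\<dots> = (\<integral>u. indicator {0..s} u * (exp (- u) * f u) \<partial>lborel)"
  proof (rule Bochner_Integration.integral_cong_AE)
    have neq: "AE u::real in lborel. u \<noteq> 0" by (rule AE_lborel_singleton)
    \<comment> \<open>Measurability of the target integrand has to come from \<open>g\<close>, which
      determines it for positive \<open>u\<close>; the single value at \<open>0\<close> is patched
      in by hand.\<close>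
    have g': "(\<lambda>u. if u = 0 then f 0 * indicator {0..s} u else exp (- u) * g u * indicator {0<..} u) \<in> borel_measurable borel"
      by measurable
    have "(\<lambda>u. if u = 0 then f 0 * indicator {0..s} u else exp (- u) * g u * indicator {0<..} u) =
        (\<lambda>u. indicator {0..s} u * (exp (- u) * f u))"
      using eq by (auto simp: fun_eq_iff indicator_def)
    with g' show "(\<lambda>u. indicator {0..s} u * (exp (- u) * f u)) \<in> borel_measurable lborel"
      by simp
    show "AE u in lborel. exponential_density 1 u * g u = indicator {0..s} u * (exp (- u) * f u)"
      using neq by eventually_elim (use eq in \<open>auto simp: exponential_density_def indicator_def\<close>)
  qed measurable
  finally show ?thesis by (simp add: set_lebesgue_integral_def)
qed

text \<open>Boundedness takes the place of continuity here. With division by zero giving zero, the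
  integrands containing \<open>q / y\<close> or \<open>q / (z - r)\<close> jump at the left endpoint
  of their interval.\<close>

lemma set_integrable_Icc_bounded:
  fixes f :: "real \<Rightarrow> real"
  assumes [measurable]: "f \<in> borel_measurable borel"
    and "\<And>y. a \<le> y \<Longrightarrow> y \<le> b \<Longrightarrow> \<bar>f y\<bar> \<le> 1"
  shows "set_integrable lborel {a..b} f"
  unfolding set_integrable_def
proof (rule Bochner_Integration.integrable_bound)
  show "integrable lborel (indicator {a..b} :: real \<Rightarrow> real)"
    by (intro integrable_real_indicator) (simp_all add: emeasure_lborel_Icc_eq)
  show "AE x in lborel. norm (indicator {a..b} x *\<^sub>R f x) \<le> norm (indicator {a..b} x :: real)"
    using assms(2) by (auto simp: indicator_def)
qed measurable

lemma LINT_exp_Icc: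
  fixes \<kappa> s :: real
  assumes "0 < \<kappa>" "0 \<le> s"
  shows "(LINT u:{0..s}|lborel. exp (- \<kappa> * u)) = (1 - exp (- \<kappa> * s)) / \<kappa>"
proof -
  have "((\<lambda>u. exp (- \<kappa> * u)) has_integral (- exp (- \<kappa> * s) / \<kappa> - - exp (- \<kappa> * 0) / \<kappa>)) {0..s}"
    using assms
    by (intro fundamental_theorem_of_calculus)
       (auto intro!: derivative_eq_intros simp flip: has_real_derivative_iff_has_vector_derivative)
  moreover have "set_integrable lborel {0..s} (\<lambda>u. exp (- \<kappa> * u))"
    using assms by (intro set_integrable_Icc_bounded) auto
  ultimately show ?thesis
    using assms by (simp add: set_borel_integral_eq_integral(2) integral_unique diff_divide_distrib)
qed

section \<open>Integration over the region bounded by the hyperbola\<close>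

text \<open>The number \<open>s\<close> is the positive root of \<open>u * u = r * u + q\<close>,
  the other root being \<open>r - s\<close>. The factor \<open>u + s - r\<close> is positive for
  \<open>u > 0\<close>, so the sign is that of \<open>u - s\<close>.\<close>

lemma hyperbola_vertex:
  fixes r q :: real
  assumes "0 < r" "0 < q"
  defines "s \<equiv> sqrt (r\<^sup>2 / 4 + q) + r / 2"
  shows "r < s" and "0 < u \<Longrightarrow> u * u \<le> r * u + q \<longleftrightarrow> u \<le> s"
proof -
  have "sqrt (r\<^sup>2 / 4 + q) > sqrt ((r / 2)\<^sup>2)"
    using assms by (intro real_sqrt_less_mono) (simp add: power2_eq_square)
  then show rs: "r < s" using assms(1) by (simp add: s_def)
  have "(s - r / 2)\<^sup>2 = r\<^sup>2 / 4 + q"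
    using assms by (simp add: s_def)
  then have fact: "u * u - r * u - q = (u - s) * (u + s - r)"
    by (simp add: power2_eq_square algebra_simps)
  assume "0 < u"
  then have "u * u - r * u - q \<le> 0 \<longleftrightarrow> u \<le> s"
    unfolding fact using rs by (simp add: mult_le_0_iff)
  then show "u * u \<le> r * u + q \<longleftrightarrow> u \<le> s" by linarith
qed

text \<open>On each side of the diagonal \<open>min\<close> is a single coordinate. Integrating the
  other coordinate first leaves the exponential probability of a slice of the region. Each side
  yields the same main term, hence the factor 2, minus one boundary integral along the hyperbola. It
  will be applied with \<open>\<gamma> = 2 * \<delta> - 1\<close>.\<close>

lemma integral_exp_law_hyperbola:
  fixes r q \<gamma> :: real
  assumes r: "0 < r" and q: "0 < q" and \<gamma>: "1 \<le> \<gamma>"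
  defines "s \<equiv> sqrt (r\<^sup>2 / 4 + q) + r / 2"
    and "f \<equiv> \<lambda>z. indicator {z. fst z * snd z \<le> r * fst z + q} z * exp (- (\<gamma> - 1) * min (fst z) (snd z))"
  shows "integrable (exp_law \<Otimes>\<^sub>M exp_law) f"
    and "(\<integral>z. f z \<partial>(exp_law \<Otimes>\<^sub>M exp_law)) = 2 * (1 - exp (- (\<gamma> + 1) * s)) / (\<gamma> + 1)
      - integral {0..s} (\<lambda>y. exp (- (r + q / y) - \<gamma> * y))
      - integral {r..s} (\<lambda>z. exp (- (q / (z - r)) - \<gamma> * z))"
proof -
  let ?D = "exp_law \<Otimes>\<^sub>M exp_law"
  note vertex = hyperbola_vertex[OF r q, folded s_def]
  have s: "r < s" "0 < s" using vertex(1) r by auto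
  define \<beta> where "\<beta> = \<gamma> - 1"
  have \<beta>: "0 \<le> \<beta>" using \<gamma> by (simp add: \<beta>_def)
  \<comment> \<open>On \<open>fst z < snd z\<close> integrate over \<open>snd z\<close> first, otherwise over \<open>fst z\<close>.\<close>
  define f1 where "f1 z = indicator {z. fst z < snd z} z * f z" for z
  define f2 where "f2 z = indicator {z. snd z \<le> fst z} z * f z" for z
  have [measurable]: "f \<in> borel_measurable ?D" "f1 \<in> borel_measurable ?D" "f2 \<in> borel_measurable ?D"
    unfolding f_def f1_def f2_def by measurable
  \<comment> \<open>The bound is claimed almost everywhere because the exponential weight can exceed
    1 where \<open>min\<close> is negative.\<close>
  have bound: "AE z in ?D. norm (f z) \<le> 1"
    using AE_exp_law_pair_pos
    by eventually_elim (use \<gamma> in \<open>auto simp: f_def indicator_def mult_nonpos_nonneg\<close>)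
  show int: "integrable ?D f"
    using bound by (rule exp_law_pair.P.integrable_const_bound) measurable
  have int1: "integrable ?D f1"
  proof (rule exp_law_pair.P.integrable_const_bound)
    show "AE z in ?D. norm (f1 z) \<le> 1"
      using bound by eventually_elim (auto simp: f1_def indicator_def)
  qed measurable
  have int2: "integrable ?D f2"
  proof (rule exp_law_pair.P.integrable_const_bound)
    show "AE z in ?D. norm (f2 z) \<le> 1"
      using bound by eventually_elim (auto simp: f2_def indicator_def)
  qed measurable

  have E0: "(LINT u:{0..s}|lborel. exp (- (\<gamma> + 1) * u)) = (1 - exp (- (\<gamma> + 1) * s)) / (\<gamma> + 1)"
    using \<gamma> s by (intro LINT_exp_Icc) auto
  have i0: "set_integrable lborel {0..s} (\<lambda>u. exp (- (\<gamma> + 1) * u))"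
    using \<gamma> by (intro set_integrable_Icc_bounded) (auto simp: mult_nonpos_nonneg)
  have i1: "set_integrable lborel {0..s} (\<lambda>y. exp (- (r + q / y) - \<gamma> * y))"
  proof (rule set_integrable_Icc_bounded)
    fix y :: real assume "0 \<le> y"
    then have "0 \<le> q / y" "0 \<le> \<gamma> * y" using q \<gamma> by simp_all
    then show "\<bar>exp (- (r + q / y) - \<gamma> * y)\<bar> \<le> 1" using r by simp
  qed measurable
  have i2: "set_integrable lborel {r..s} (\<lambda>z. exp (- (q / (z - r)) - \<gamma> * z))"
  proof (rule set_integrable_Icc_bounded)
    fix z assume "r \<le> z"
    then have "0 \<le> q / (z - r)" "0 \<le> \<gamma> * z" using r q \<gamma> by simp_all
    then show "\<bar>exp (- (q / (z - r)) - \<gamma> * z)\<bar> \<le> 1" by simp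
  qed measurable

  \<comment> \<open>The slice at \<open>u\<close> is the interval from the diagonal up to the
    hyperbola. It is empty once \<open>u > s\<close>, which is where the cutoff at \<open>s\<close>
    comes from.\<close>
  have inner1: "(\<integral>v. f1 (u, v) \<partial>exp_law) =
      indicator {..s} u * (exp (- \<beta> * u) * (exp (- u) - exp (- (r + q / u))))" if u: "0 < u" for u
  proof -
    have "(\<integral>v. f1 (u, v) \<partial>exp_law) = (\<integral>v. exp (- \<beta> * u) * indicator {u<..r + q / u} v \<partial>exp_law)"
    proof (rule Bochner_Integration.integral_cong[OF refl])
      fix v
      have "u * v \<le> r * u + q \<longleftrightarrow> v \<le> r + q / u" using u by (simp add: field_simps)
      then show "f1 (u, v) = exp (- \<beta> * u) * indicator {u<..r + q / u} v"
        by (auto simp: f1_def f_def \<beta>_def indicator_def min_def)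
    qed
    also have "\<dots> = exp (- \<beta> * u) * measure exp_law {u<..r + q / u}" by simp
    also have "measure exp_law {u<..r + q / u} = indicator {..s} u * (exp (- u) - exp (- (r + q / u)))"
    proof (cases "u \<le> s")
      case True
      then have "u \<le> r + q / u" using vertex(2)[OF u] u by (simp add: field_simps)
      then show ?thesis using True u by (simp add: measure_exp_law_greaterThanAtMost)
    next
      case False
      then have "r + q / u < u" using vertex(2)[OF u] u by (simp add: field_simps)
      then show ?thesis using False by simp
    qed
    finally show ?thesis by simp
  qed
  have "(\<integral>z. f1 z \<partial>?D) = (\<integral>u. (\<integral>v. f1 (u, v) \<partial>exp_law) \<partial>exp_law)"
    by (rule exp_law_pair.integral_fst'[OF int1, symmetric])
  also have "\<dots> = (LINT u:{0..s}|lborel. exp (- u) * (exp (- \<beta> * u) * (exp (- u) - exp (- (r + q / u)))))"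
    using inner1 s by (intro integral_exp_law_Icc) auto
  also have "\<dots> = (LINT u:{0..s}|lborel. exp (- (\<gamma> + 1) * u) - exp (- (r + q / u) - \<gamma> * u))"
    by (intro set_lebesgue_integral_cong)
       (auto simp: \<beta>_def algebra_simps simp flip: exp_add)
  also have "\<dots> = (LINT u:{0..s}|lborel. exp (- (\<gamma> + 1) * u)) - (LINT u:{0..s}|lborel. exp (- (r + q / u) - \<gamma> * u))"
    by (rule set_integral_diff(2)[OF i0 i1])
  finally have part1: "(\<integral>z. f1 z \<partial>?D) = (1 - exp (- (\<gamma> + 1) * s)) / (\<gamma> + 1) -
      integral {0..s} (\<lambda>y. exp (- (r + q / y) - \<gamma> * y))"
    unfolding E0 set_borel_integral_eq_integral(2)[OF i1] .

  \<comment> \<open>For \<open>z \<le> r\<close> the slice never meets the hyperbola and is a full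
    half-line; for \<open>z > r\<close> it stops at \<open>q / (z - r)\<close>. Hence the boundary
    term appears only beyond \<open>r\<close>.\<close>
  have inner2: "(\<integral>u. f2 (u, z) \<partial>exp_law) =
      indicator {..s} z * (exp (- \<beta> * z) * (exp (- z) - indicator {r<..} z * exp (- (q / (z - r)))))"
    if z: "0 < z" for z
  proof -
    define B where "B = {u. z \<le> u \<and> u * z \<le> r * u + q}"
    have "(\<integral>u. f2 (u, z) \<partial>exp_law) = (\<integral>u. exp (- \<beta> * z) * indicator B u \<partial>exp_law)"
      by (rule Bochner_Integration.integral_cong[OF refl])
         (auto simp: f2_def f_def \<beta>_def B_def indicator_def min_def)
    also have "\<dots> = exp (- \<beta> * z) * measure exp_law B" by simp
    also have "measure exp_law B = indicator {..s} z * (exp (- z) - indicator {r<..} z * exp (- (q / (z - r))))"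
    proof (cases "z \<le> r")
      case True
      have "u * z \<le> r * u + q" if "z \<le> u" for u
      proof -
        have "z * u \<le> r * u" using True that z by (intro mult_right_mono) auto
        then show ?thesis using q by (simp add: mult.commute[of u z])
      qed
      then have "B = {z..}" by (auto simp: B_def)
      then show ?thesis using True s z by (simp add: measure_exp_law_atLeast)
    next
      case False
      then have B: "B = {z..q / (z - r)}" by (auto simp: B_def field_simps)
      show ?thesis
      proof (cases "z \<le> s")
        case True
        then have "z \<le> q / (z - r)" using vertex(2)[OF z] False by (simp add: field_simps)
        then show ?thesis using True False z by (simp add: measure_exp_law_atLeastAtMost B)
      next
        case nle: False
        then have "q / (z - r) < z" using vertex(2)[OF z] False by (simp add: field_simps)
        then show ?thesis using nle by (simp add: B)
      qed
    qed
    finally show ?thesis by simp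
  qed
  \<comment> \<open>The boundary term is extended by zero to \<open>{0..s}\<close>, so that it can
    be subtracted from the main term under one integral.\<close>
  have i2': "set_integrable lborel {0..s} (\<lambda>z. indicator {r..s} z * exp (- (q / (z - r)) - \<gamma> * z))"
  proof (rule set_integrable_Icc_bounded)
    fix z :: real
    have "0 \<le> q / (z - r)" "0 \<le> \<gamma> * z" if "r \<le> z" using that r q \<gamma> by simp_all
    then show "\<bar>indicator {r..s} z * exp (- (q / (z - r)) - \<gamma> * z)\<bar> \<le> 1"
      by (auto simp: indicator_def)
  qed measurable
  have "(\<integral>z. f2 z \<partial>?D) = (\<integral>z. (\<integral>u. f2 (u, z) \<partial>exp_law) \<partial>exp_law)"
    using exp_law_pair.integral_snd[of "\<lambda>u z. f2 (u, z)"] int2 by simp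
  also have "\<dots> = (LINT z:{0..s}|lborel. exp (- z) * (exp (- \<beta> * z) *
      (exp (- z) - indicator {r<..} z * exp (- (q / (z - r))))))"
    using inner2 s by (intro integral_exp_law_Icc) auto
  also have "\<dots> = (LINT z:{0..s}|lborel. exp (- (\<gamma> + 1) * z) - indicator {r..s} z * exp (- (q / (z - r)) - \<gamma> * z))"
    unfolding set_lebesgue_integral_def
  proof (rule Bochner_Integration.integral_cong_AE)
    \<comment> \<open>The indicators of \<open>{r<..}\<close> and \<open>{r..s}\<close> disagree
      within \<open>{0..s}\<close> only at \<open>z = r\<close>, a null set.\<close>
    have "AE z in lborel. z \<noteq> r" by (rule AE_lborel_singleton)
    then show "AE z in lborel. indicator {0..s} z *\<^sub>R (exp (- z) * (exp (- \<beta> * z) *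
        (exp (- z) - indicator {r<..} z * exp (- (q / (z - r)))))) =
        indicator {0..s} z *\<^sub>R (exp (- (\<gamma> + 1) * z) - indicator {r..s} z * exp (- (q / (z - r)) - \<gamma> * z))"
      by eventually_elim
        (auto simp: \<beta>_def indicator_def algebra_simps simp flip: exp_add)
  qed measurable
  also have "\<dots> = (LINT z:{0..s}|lborel. exp (- (\<gamma> + 1) * z)) -
      (LINT z:{0..s}|lborel. indicator {r..s} z * exp (- (q / (z - r)) - \<gamma> * z))"
    by (rule set_integral_diff(2)[OF i0 i2'])
  also have "(LINT z:{0..s}|lborel. indicator {r..s} z * exp (- (q / (z - r)) - \<gamma> * z)) =
      (LINT z:{r..s}|lborel. exp (- (q / (z - r)) - \<gamma> * z))"
    unfolding set_lebesgue_integral_def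
    using r by (intro Bochner_Integration.integral_cong) (auto simp: indicator_def)
  finally have part2: "(\<integral>z. f2 z \<partial>?D) = (1 - exp (- (\<gamma> + 1) * s)) / (\<gamma> + 1) -
      integral {r..s} (\<lambda>z. exp (- (q / (z - r)) - \<gamma> * z))"
    unfolding E0 set_borel_integral_eq_integral(2)[OF i2] .

  have "(\<integral>z. f z \<partial>?D) = (\<integral>z. f1 z + f2 z \<partial>?D)"
    by (intro Bochner_Integration.integral_cong) (auto simp: f1_def f2_def indicator_def)
  also have "\<dots> = (\<integral>z. f1 z \<partial>?D) + (\<integral>z. f2 z \<partial>?D)"
    using int1 int2 by (rule Bochner_Integration.integral_add)
  finally show "(\<integral>z. f z \<partial>?D) = 2 * (1 - exp (- (\<gamma> + 1) * s)) / (\<gamma> + 1)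
      - integral {0..s} (\<lambda>y. exp (- (r + q / y) - \<gamma> * y))
      - integral {r..s} (\<lambda>z. exp (- (q / (z - r)) - \<gamma> * z))"
    unfolding part1 part2 by (simp add: field_simps)
qed

section \<open>The minimum of two exponentials, the SNR condition and the final assembly\<close>

lemma measure_exp_law_pair_min_greater:
  assumes "0 \<le> y"
  shows "measure (exp_law \<Otimes>\<^sub>M exp_law) {z \<in> space (borel \<Otimes>\<^sub>M borel). y < min (fst z) (snd z)} = exp (- 2 * y)"
proof -
  have "{z \<in> space (borel \<Otimes>\<^sub>M borel). y < min (fst z) (snd z)} = {y<..} \<times> {y<..}"
    by (auto simp: space_pair_measure)
  then show ?thesis
    using assms
    by (simp add: measure_def exp_law.emeasure_pair_measure_Times enn2real_mult)
       (simp add: measure_exp_law_greaterThan flip: measure_def exp_add)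
qed

text \<open>If the minimum equals \<open>y\<close>, one of the coordinates does, which is a null
  event. This supplies the atomlessness that excludes ties.\<close>

lemma measure_exp_law_pair_min_eq:
  "measure (exp_law \<Otimes>\<^sub>M exp_law) {z \<in> space (borel \<Otimes>\<^sub>M borel). min (fst z) (snd z) = y} = 0"
proof -
  have neq: "AE u in exp_law. u \<noteq> y"
    using exp_law.prob_eq_0[of "{y}"] by (simp add: measure_exp_law_singleton)
  have "AE z in exp_law \<Otimes>\<^sub>M exp_law. fst z \<noteq> y \<and> snd z \<noteq> y"
  proof (rule exp_law_pair.AE_pair_measure)
    show "AE u in exp_law. AE v in exp_law. fst (u, v) \<noteq> y \<and> snd (u, v) \<noteq> y"
      using neq by simp
  qed measurable
  then have "AE z in exp_law \<Otimes>\<^sub>M exp_law. z \<notin> {z \<in> space (borel \<Otimes>\<^sub>M borel). min (fst z) (snd z) = y}"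
    by eventually_elim (auto simp: min_def)
  then show ?thesis
    by (subst exp_law_pair.P.prob_eq_0) auto
qed

text \<open>Subtracting \<open>b / c\<close> leaves a harvested energy proportional to
  \<open>Pt * u / (Pt * u + c)\<close> with a positive constant. Clearing positive denominators
  turns the SNR threshold into the hyperbola condition.\<close>

lemma snr_le_iff:
  fixes a b c Pt N t1 x u v :: real
  assumes "Pt > 0" "N > 0" "0 < t1" "t1 < 1" "c > 0" "a * c - b > 0" "u > 0"
  defines "r \<equiv> N * c * (1 - t1) * x / (t1 * (a * c - b))"
  shows "snr a b c Pt t1 N u v \<le> x \<longleftrightarrow> u * v \<le> r * u + c * r / Pt"
proof -
  define K where "K = t1 * (a * c - b)"
  define L where "L = N * c * (1 - t1)"
  have pos: "K > 0" "L > 0" "Pt * u + c > 0"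
    using assms by (auto simp: K_def L_def add_pos_pos)
  have r: "r = L * x / K" by (simp add: r_def K_def L_def)
  have "(a * Pt * u + b) / (Pt * u + c) - b / c = Pt * u * (a * c - b) / (c * (Pt * u + c))"
    using pos assms by (simp add: field_simps)
  then have "snr a b c Pt t1 N u v = v * Pt * u * K / (L * (Pt * u + c))"
    by (simp add: snr_def harvested_energy_def K_def L_def mult_ac)
  also have "\<dots> \<le> x \<longleftrightarrow> Pt * (u * v) \<le> r * (Pt * u + c)"
    using pos mult_pos_pos[OF pos(2,3)] by (simp add: r pos_divide_le_eq) (simp add: field_simps)
  also have "\<dots> \<longleftrightarrow> u * v \<le> r * u + c * r / Pt"
    using assms(1) by (simp add: field_simps)
  finally show ?thesis .
qed

theorem theorem5:
  fixes P :: "'a measure"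
    and M k :: nat
    and G H :: "nat \<Rightarrow> 'a \<Rightarrow> real"
    and a b c Pt N t1 t2 x r s :: real
    and v w :: "real \<Rightarrow> real"
  assumes "prob_space P"
    and "M \<ge> 1"
    and "\<And>i. i \<in> {1..M} \<Longrightarrow> distributed P lborel (G i) (exponential_density 1)"
    and "\<And>i. i \<in> {1..M} \<Longrightarrow> distributed P lborel (H i) (exponential_density 1)"
    and "prob_space.indep_vars P (\<lambda>_. borel) (case_sum G H) ({1..M} <+> {1..M})"
    and "Pt > 0" and "N > 0"
    and "0 < t1" and "t1 < 1" and "t2 = 1 - t1"
    and "c > 0" and "a * c - b > 0"
    and "1 \<le> k" and "k \<le> M" and "x > 0"
    and "r = N * c * t2 * x / (t1 * (a * c - b))"
    and "s = sqrt (r\<^sup>2 / 4 + c * r / Pt) + r / 2"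
    and "\<And>y. w y = r + c * r / (Pt * y)"
    and "\<And>z. v z = - (c * r / (Pt * (r - z)))"
  shows "mms_outage P M G H a b c Pt t1 N k x =
    real k * real (M choose k) *
      (\<Sum>m = 0..M - k. (-1) ^ m * real ((M - k) choose m) *
        (let \<delta> = real (k + m) in
          (1 - exp (- 2 * \<delta> * s)) / \<delta>
          - integral {0..s} (\<lambda>y. exp (- w y - (2 * \<delta> - 1) * y))
          - integral {r..s} (\<lambda>z. exp (- v z - (2 * \<delta> - 1) * z))))"
proof -
  interpret prob_space P by fact
  let ?B = "borel \<Otimes>\<^sub>M borel :: (real \<times> real) measure"
  let ?D = "exp_law \<Otimes>\<^sub>M exp_law"
  define \<rho> :: "real \<times> real \<Rightarrow> real" where "\<rho> z = min (fst z) (snd z)" for z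
  define Z where "Z i \<omega> = (G i \<omega>, H i \<omega>)" for i \<omega>
  define A where "A = {z \<in> space ?B. snr a b c Pt t1 N (fst z) (snd z) \<le> x}"
  define T where "T z = measure ?D {z' \<in> space ?B. \<rho> z' > \<rho> z}" for z
  define q where "q = c * r / Pt"
  \<comment> \<open>The exponent is kept as \<open>(2 * \<delta> - 1) - 1\<close> so that it matches
    the hyperbola integral with \<open>\<gamma> = 2 * \<delta> - 1\<close>.\<close>
  define f where "f \<delta> z = indicator {z. fst z * snd z \<le> r * fst z + q} z *
    exp (- ((2 * \<delta> - 1) - 1) * min (fst z) (snd z))" for \<delta> :: real and z
  define I where "I \<delta> = (1 - exp (- 2 * \<delta> * s)) / \<delta>
    - integral {0..s} (\<lambda>y. exp (- w y - (2 * \<delta> - 1) * y))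
    - integral {r..s} (\<lambda>z. exp (- v z - (2 * \<delta> - 1) * z))" for \<delta>
  note indep = assms(5)
  have r: "r > 0" and q: "q > 0" using assms by (auto simp: q_def)
  have s: "s = sqrt (r\<^sup>2 / 4 + q) + r / 2" using assms by (simp add: q_def)

  \<comment> \<open>Different pairs are functions of disjoint blocks \<open>{Inl j, Inr j}\<close>
    of the independent family.\<close>
  have indepZ: "indep_vars (\<lambda>_. ?B) Z {1..M}"
  proof -
    have "indep_vars (\<lambda>j. PiM {Inl j, Inr j} (\<lambda>_. borel))
        (\<lambda>j \<omega>. restrict (\<lambda>l. case_sum G H l \<omega>) {Inl j, Inr j}) {1..M}"
      by (rule indep_vars_restrict[OF indep]) (auto simp: disjoint_family_on_def)
    then have "indep_vars (\<lambda>_. ?B) (\<lambda>j \<omega>. (\<lambda>f. (f (Inl j), f (Inr j)))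
        (restrict (\<lambda>l. case_sum G H l \<omega>) {Inl j, Inr j})) {1..M}"
      by (rule indep_vars_compose2) (intro measurable_Pair measurable_component_singleton; simp)
    then show ?thesis by (simp add: Z_def[abs_def])
  qed
  have law: "distr P ?B (Z j) = ?D" if j: "j \<in> {1..M}" for j
  proof -
    have "indep_var borel (case_sum G H (Inl j)) borel (case_sum G H (Inr j))"
      using j by (intro indep_vars_pair[OF indep]) auto
    then have "distr P ?B (Z j) = distr P borel (G j) \<Otimes>\<^sub>M distr P borel (H j)"
      unfolding indep_var_distribution_eq by (simp add: Z_def[abs_def])
    moreover have "distr P borel X = exp_law"
      if "distributed P lborel X (exponential_density 1)" for X
      using that by (simp add: distributed_def cong: distr_cong)
    ultimately show ?thesis using assms(3,4) j by simp
  qed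
  have [measurable]: "\<rho> \<in> borel_measurable ?B" unfolding \<rho>_def by measurable
  have A: "A \<in> sets ?B"
    unfolding A_def snr_def harvested_energy_def by measurable

  have "mms_outage P M G H a b c Pt t1 N k x =
      prob {\<omega> \<in> space P. Z (kth_largest_index M k (\<lambda>i. \<rho> (Z i \<omega>))) \<omega> \<in> A}"
    by (simp add: mms_outage_def mms_index_def Let_def Z_def \<rho>_def A_def space_pair_measure)
  also have "\<dots> = real k * real (M choose k) *
      (\<integral>z. indicator A z * (T z ^ (k - 1) * (1 - T z) ^ (M - k)) \<partial>?D)"
    unfolding T_def
    using assms indepZ law A
    by (intro prob_kth_largest) (auto simp: \<rho>_def measure_exp_law_pair_min_eq)
  also have "(\<integral>z. indicator A z * (T z ^ (k - 1) * (1 - T z) ^ (M - k)) \<partial>?D) =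
      (\<integral>z. (\<Sum>m = 0..M - k. (-1) ^ m * real ((M - k) choose m) * f (real (k + m)) z) \<partial>?D)"
  proof (rule Bochner_Integration.integral_cong_AE)
    \<comment> \<open>The tail probability decreases in the threshold; its negative is monotone and
      therefore Borel, which makes \<open>T\<close> measurable.\<close>
    have "mono (\<lambda>y. - measure ?D {z' \<in> space ?B. \<rho> z' > y})"
      by (intro monoI, simp, intro exp_law_pair.P.finite_measure_mono) auto
    then have "(\<lambda>y. - measure ?D {z' \<in> space ?B. \<rho> z' > y}) \<in> borel_measurable borel"
      by (rule borel_measurable_mono)
    then have "(\<lambda>y. - (- measure ?D {z' \<in> space ?B. \<rho> z' > y})) \<in> borel_measurable borel"
      by (rule borel_measurable_uminus)
    then have [measurable]: "T \<in> borel_measurable ?B"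
      using measurable_compose[of \<rho> ?B borel] by (simp add: T_def[abs_def])
    show "(\<lambda>z. indicator A z * (T z ^ (k - 1) * (1 - T z) ^ (M - k))) \<in> borel_measurable ?D"
      using A by measurable
    show "(\<lambda>z. \<Sum>m = 0..M - k. (-1) ^ m * real ((M - k) choose m) * f (real (k + m)) z) \<in> borel_measurable ?D"
      unfolding f_def by measurable
    show "AE z in ?D. indicator A z * (T z ^ (k - 1) * (1 - T z) ^ (M - k)) =
        (\<Sum>m = 0..M - k. (-1) ^ m * real ((M - k) choose m) * f (real (k + m)) z)"
      \<comment> \<open>On the positive quadrant \<open>T z\<close> has its closed form and the SNR
        condition is the hyperbola condition.\<close>
      using AE_exp_law_pair_pos
    proof eventually_elim
      case (elim z)
      let ?e = "exp (- 2 * \<rho> z)"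
      have T: "T z = ?e"
        using measure_exp_law_pair_min_greater[of "\<rho> z"] elim by (simp add: T_def \<rho>_def)
      have ind: "indicator A z = (indicator {z. fst z * snd z \<le> r * fst z + q} z :: real)"
        using snr_le_iff[of Pt N t1 c a b "fst z" "snd z" x] elim assms
        by (simp add: A_def indicator_def q_def space_pair_measure)
      \<comment> \<open>The exponents add up as
        \<open>2 * (k - 1) + 2 * m = 2 * (\<delta> - 1)\<close> with
        \<open>\<delta> = k + m\<close>.\<close>
      have exp: "?e ^ (k - 1) * ?e ^ m = exp (- ((2 * real (k + m) - 1) - 1) * \<rho> z)" for m
        using \<open>1 \<le> k\<close>
        by (simp add: of_nat_diff algebra_simps flip: exp_of_nat_mult exp_add)
      \<comment> \<open>Written as a sum with \<open>- T z\<close> first, so that the binomial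
        theorem yields ascending powers of \<open>T z\<close> with alternating signs.\<close>
      have "(1 - T z) ^ (M - k) = (- T z + 1) ^ (M - k)" by simp
      also have "\<dots> = (\<Sum>m = 0..M - k. (-1) ^ m * real ((M - k) choose m) * T z ^ m)"
        unfolding binomial_ring by (simp add: atMost_atLeast0 power_minus[of "T z"] mult_ac)
      finally show ?case
        unfolding ind T f_def \<rho>_def[symmetric] exp[symmetric]
        by (simp add: sum_distrib_left mult_ac)
    qed
  qed
  also have "\<dots> = (\<Sum>m = 0..M - k. (-1) ^ m * real ((M - k) choose m) * (\<integral>z. f (real (k + m)) z \<partial>?D))"
  proof -
    have "integrable ?D (f (real (k + m)))" for m
      unfolding f_def using \<open>1 \<le> k\<close> by (intro integral_exp_law_hyperbola(1) r q) auto
    then show ?thesis by simp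
  qed
  also have "\<dots> = (\<Sum>m = 0..M - k. (-1) ^ m * real ((M - k) choose m) * I (real (k + m)))"
  proof (intro sum.cong refl arg_cong2[where f="(*)"])
    fix m
    let ?\<delta> = "real (k + m)"
    have wv: "w y = r + q / y" "v y = q / (y - r)" for y
      using assms by (simp_all add: q_def minus_divide_right minus_mult_right)
    have \<delta>: "1 \<le> 2 * ?\<delta> - 1" using \<open>1 \<le> k\<close> by simp
    \<comment> \<open>Since \<open>\<gamma> + 1 = 2 * \<delta>\<close>, the factor 2 from the two
      sides of the diagonal cancels.\<close>
    have \<delta>_eq: "2 * y / (2 * d - 1 + 1) = y / d" "- (2 * d - 1 + 1) * y = - 2 * d * y" for d y :: real
      by simp_all
    show "(\<integral>z. f ?\<delta> z \<partial>?D) = I ?\<delta>"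
      using integral_exp_law_hyperbola(2)[OF r q \<delta>, folded s] unfolding \<delta>_eq
      by (simp only: f_def I_def wv)
  qed
  finally show ?thesis unfolding I_def Let_def .
qed

end
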